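(* Let $\mathsf{A}\in\mathbb{R}^{J_1\times J_1\times\cdots\times J_N\times J_N}$ and $\mathsf{B}\in\mathbb{R}^{J_1\times K_1\times\cdots\times J_N\times K_N}$, and let $\Pi_{\mathcal{J}}=\prod_{n=1}^NJ_n$. The pair $(\mathsf{A},\mathsf{B})$ is reachable if and only if the $J_1\times J_1K_1\times\cdots\times J_N\times J_NK_N$ even-order reachability tensor $$\mathscr{R}=\begin{vmatrix}\mathsf{B}&\mathsf{A}*\mathsf{B}&\cdots&\mathsf{A}^{\Pi_{\mathcal{J}}-1}*\mathsf{B}\end{vmatrix}$$ spans $\mathbb{R}^{J_1\times J_2\times\cdots\times J_N}$, in other words, $\operatorname{rank}_U(\mathscr{R})=\Pi_{\mathcal{J}}$.
   Context: Einstein products: $(\mathsf{A}*\mathsf{X})_{j_1\cdots j_N}=\sum_{i_1,\dots,i_N}\mathsf{A}_{j_1i_1\cdots j_Ni_N}\mathsf{X}_{i_1\cdots i_N}$ for an $N$-th order $\mathsf{X}$, and $(\mathsf{A}*\mathsf{B})_{j_1i_1\cdots j_Ni_N}=\sum_{k_1,\dots,k_N}\mathsf{A}_{j_1k_1\cdots j_Nk_N}\mathsf{B}_{k_1i_1\cdots k_Ni_N}$ for even-order paired tensors; $\mathsf{A}^k$ is the $k$-fold Einstein product, $\mathsf{A}^0$ being the identity tensor for $*$. The pair $(\mathsf{A},\mathsf{B})$ is reachable on $[t_0,t_1]$ ($t_0<t_1$ integers) if for any $\mathsf{X}_0,\mathsf{X}_1\in\mathbb{R}^{J_1\times\cdots\times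 J_N}$ there are inputs $\mathsf{U}_t\in\mathbb{R}^{K_1\times\cdots\times K_N}$, $t_0\le t\le t_1-1$, steering $\mathsf{X}_{t+1}=\mathsf{A}*\mathsf{X}_t+\mathsf{B}*\mathsf{U}_t$ from $\mathsf{X}_{t_0}=\mathsf{X}_0$ to $\mathsf{X}_{t_1}=\mathsf{X}_1$. The pair is reachable if it is reachable on some interval $[t_0,t_1]$. Mode row block tensor: given $P=P_1\cdots P_N$ tensors $\mathsf{Z}_1,\dots,\mathsf{Z}_P\in\mathbb{R}^{J_1\times K_1\times\cdots\times J_N\times K_N}$, the tensor $\begin{vmatrix}\mathsf{Z}_1&\cdots&\mathsf{Z}_P\end{vmatrix}\in\mathbb{R}^{J_1\times K_1P_1\times\cdots\times J_N\times K_NP_N}$ is obtained by concatenating consecutive groups of $P_1$ tensors along the second index of the first pair, then consecutive groups of $P_2$ of the results along the second index of the second pair, and so on; explicitly its entry at $(j_1,l_1,\dots,j_N,l_N)$ with $l_n=(p_n-1)K_n+k_n$, $1\le k_n\le K_n$, $1\le p_n\le P_n$, is $(\mathsf{Z}_p)_{j_1k_1\cdots j_Nk_N}$ with $p=p_1+\sum_{n=2}^N(p_n-1)\prod_{l=1}^{n-1}P_l$. For $\mathscr{R}$ one takes $P_n=J_n$ and $\mathsf{Z}_p=\mathsf{A}^{p-1}*\mathsf{B}$. The unfolding rank $\operatorname{rank}_U(\mathsf{M})$ of $\mathsf{M}\in\mathbb{R}^{P_1\times Q_1\times\cdots\times P_N\times Q_N}$ is the rank of its unfolding matrix $\varphi(\mathsf{M})$,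 the $\prod_nP_n\times\prod_nQ_n$ matrix with rows indexed by $(p_1,\dots,p_N)$, columns indexed by $(q_1,\dots,q_N)$ (first index varying fastest) and entries $\mathsf{M}_{p_1q_1\cdots p_Nq_N}$. *)

theory Defs
  imports Complex_Main "Jordan_Normal_Form.DL_Rank"
begin

text \<open>
  A tensor with mode sizes J = [J_1, ..., J_N] is a function on multi-indices, and an even-order
  paired tensor with mode sizes J_1 x K_1 x ... x J_N x K_N is a curried function of its row and
  column multi-indices: A j k stands for the entry at (j_1, k_1, ..., j_N, k_N).  All indices count
  from 0.  Only the entries at multi-indices in idx J (and idx K) belong to the tensor; values of the
  function elsewhere are never read, so equality of tensors is equality on these sets.
\<close>

type_synonym tensor = "nat list \<Rightarrow> real"
type_synonym paired_tensor = "nat list \<Rightarrow> nat list \<Rightarrow> real"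

definition idx :: "nat list \<Rightarrow> nat list set" where
  "idx J = {j. length j = length J \<and> (\<forall>n<length J. j ! n < J ! n)}"

definition einstein_vec :: "nat list \<Rightarrow> paired_tensor \<Rightarrow> tensor \<Rightarrow> tensor" where
  "einstein_vec I A X = (\<lambda>j. \<Sum>i\<in>idx I. A j i * X i)"

definition einstein :: "nat list \<Rightarrow> paired_tensor \<Rightarrow> paired_tensor \<Rightarrow> paired_tensor" where
  "einstein I A B = (\<lambda>j i. \<Sum>k\<in>idx I. A j k * B k i)"

definition id_tensor :: paired_tensor where
  "id_tensor = (\<lambda>j i. if j = i then 1 else 0)"

primrec einstein_pow :: "nat list \<Rightarrow> paired_tensor \<Rightarrow> nat \<Rightarrow> paired_tensor" where
  "einstein_pow J A 0 = id_tensor"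
| "einstein_pow J A (Suc k) = einstein J A (einstein_pow J A k)"

definition reachable_on ::
    "nat list \<Rightarrow> nat list \<Rightarrow> paired_tensor \<Rightarrow> paired_tensor \<Rightarrow> int \<Rightarrow> int \<Rightarrow> bool" where
  "reachable_on J K A B t0 t1 \<longleftrightarrow>
     (\<forall>X0 X1 :: tensor. \<exists>(U :: int \<Rightarrow> tensor) (X :: int \<Rightarrow> tensor).
        (\<forall>j\<in>idx J. X t0 j = X0 j) \<and>
        (\<forall>t. t0 \<le> t \<and> t \<le> t1 - 1 \<longrightarrow>
           (\<forall>j\<in>idx J. X (t + 1) j = einstein_vec J A (X t) j + einstein_vec K B (U t) j)) \<and>
        (\<forall>j\<in>idx J. X t1 j = X1 j))"

definition reachable ::
    "nat list \<Rightarrow> nat list \<Rightarrow> paired_tensor \<Rightarrow> paired_tensor \<Rightarrow> bool" where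
  "reachable J K A B \<longleftrightarrow> (\<exists>t0 t1. t0 < t1 \<and> reachable_on J K A B t0 t1)"

text \<open>Position of a multi-index in the ordering where the first index varies fastest.\<close>

definition lin_idx :: "nat list \<Rightarrow> nat list \<Rightarrow> nat" where
  "lin_idx P p = (\<Sum>n<length P. p ! n * (\<Prod>l<n. P ! l))"

text \<open>
  Mode row block tensor of Z 0, ..., Z (prod_list P - 1), each with column sizes K.  Counting from 0,
  the n-th column index is l_n = p_n * K_n + k_n, with k_n < K_n the index inside the block and
  p_n the block coordinate.  The column sizes of the result are K_n * P_n.
\<close>

definition row_block ::
    "nat list \<Rightarrow> nat list \<Rightarrow> (nat \<Rightarrow> paired_tensor) \<Rightarrow> paired_tensor" where
  "row_block K P Z = (\<lambda>j l. Z (lin_idx P (map2 (div) l K)) j (map2 (mod) l K))"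

text \<open>Row sizes J, column sizes map2 (*) J K.\<close>

definition reach_tensor ::
    "nat list \<Rightarrow> nat list \<Rightarrow> paired_tensor \<Rightarrow> paired_tensor \<Rightarrow> paired_tensor" where
  "reach_tensor J K A B = row_block K J (\<lambda>p. einstein J (einstein_pow J A p) B)"

definition unfold_mat :: "nat list \<Rightarrow> nat list \<Rightarrow> paired_tensor \<Rightarrow> real mat" where
  "unfold_mat P Q M =
     mat (prod_list P) (prod_list Q)
       (\<lambda>(r, c). M (inv_into (idx P) (lin_idx P) r) (inv_into (idx Q) (lin_idx Q) c))"

definition rank_U :: "nat list \<Rightarrow> nat list \<Rightarrow> paired_tensor \<Rightarrow> nat" where
  "rank_U P Q M = vec_space.rank (prod_list P) (unfold_mat P Q M)"

text \<open>
  M spans the space of tensors with mode sizes P: every such tensor is a linear combination of the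
  subtensors M(-, q) obtained by fixing the column multi-index q.
\<close>

definition spans :: "nat list \<Rightarrow> nat list \<Rightarrow> paired_tensor \<Rightarrow> bool" where
  "spans P Q M \<longleftrightarrow>
     (\<forall>X :: tensor. \<exists>C :: tensor. \<forall>p\<in>idx P. X p = (\<Sum>q\<in>idx Q. C q * M p q))"

lemma lin_idx_Nil: "lin_idx [] p = 0"
  by (simp add: lin_idx_def)

lemma lin_idx_Cons: "lin_idx (a # P) (i # p) = i + a * lin_idx P p"
proof -
  have "lin_idx (a # P) (i # p) = i + (\<Sum>n<length P. p ! n * (a * (\<Prod>l<n. P ! l)))"
    unfolding lin_idx_def length_Cons sum.lessThan_Suc_shift prod.lessThan_Suc_shift by simp
  then show ?thesis
    unfolding lin_idx_def sum_distrib_left by (simp only: mult.left_commute)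
qed

lemma idx_Nil: "idx [] = {[]}"
  by (auto simp: idx_def)

lemma Cons_in_idx: "i # p \<in> idx (a # P) \<longleftrightarrow> i < a \<and> p \<in> idx P"
  by (auto simp: idx_def All_less_Suc2)

lemma in_idx_ConsE:
  assumes "x \<in> idx (a # P)"
  obtains i p where "x = i # p" "i < a" "p \<in> idx P"
proof (cases x)
  case Nil
  then show ?thesis using assms by (simp add: idx_def)
next
  case (Cons i p)
  then show ?thesis using assms that Cons_in_idx by blast
qed

lemma bij_betw_lin_idx: "bij_betw (lin_idx P) (idx P) {..<prod_list P}"
proof (induction P)
  case Nil
  show ?case by (simp add: bij_betw_def idx_Nil lin_idx_Nil lessThan_Suc)
next
  case (Cons a P)
  have inj: "inj_on (lin_idx P) (idx P)" and img: "lin_idx P ` idx P = {..<prod_list P}"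
    using Cons by (auto simp: bij_betw_def)
  show ?case
  proof (rule bij_betw_imageI)
    show "inj_on (lin_idx (a # P)) (idx (a # P))"
    proof (rule inj_onI)
      fix x y assume x: "x \<in> idx (a # P)" and y: "y \<in> idx (a # P)"
        and eq: "lin_idx (a # P) x = lin_idx (a # P) y"
      obtain i p where 1: "x = i # p" "i < a" "p \<in> idx P" using x by (rule in_idx_ConsE)
      obtain j q where 2: "y = j # q" "j < a" "q \<in> idx P" using y by (rule in_idx_ConsE)
      have e: "i + a * lin_idx P p = j + a * lin_idx P q" using eq 1 2 by (simp add: lin_idx_Cons)
      have "i = j" using arg_cong[OF e, of "\<lambda>z. z mod a"] 1 2 by simp
      moreover have "lin_idx P p = lin_idx P q" using arg_cong[OF e, of "\<lambda>z. z div a"] 1 2 by simp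
      ultimately show "x = y" using inj 1 2 by (auto dest: inj_onD)
    qed
    show "lin_idx (a # P) ` idx (a # P) = {..<prod_list (a # P)}"
    proof (intro equalityI subsetI)
      fix z assume "z \<in> lin_idx (a # P) ` idx (a # P)"
      then obtain x where x: "x \<in> idx (a # P)" "z = lin_idx (a # P) x" by blast
      obtain i p where 1: "x = i # p" "i < a" "p \<in> idx P" using x(1) by (rule in_idx_ConsE)
      have "lin_idx P p < prod_list P" using img 1 by blast
      then have "a * Suc (lin_idx P p) \<le> a * prod_list P" by (intro mult_le_mono2) simp
      then show "z \<in> {..<prod_list (a # P)}" using x 1 by (simp add: lin_idx_Cons)
    next
      fix z assume "z \<in> {..<prod_list (a # P)}"
      then have z: "z < a * prod_list P" by simp
      then have a: "a > 0" by (cases a) auto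
      have "z div a < prod_list P" using z by (simp add: less_mult_imp_div_less mult.commute)
      then have "z div a \<in> lin_idx P ` idx P" unfolding img by simp
      then obtain p where p: "p \<in> idx P" "lin_idx P p = z div a" by (elim imageE) simp
      have "z = lin_idx (a # P) ((z mod a) # p)" using p(2) by (simp add: lin_idx_Cons)
      moreover have "(z mod a) # p \<in> idx (a # P)" using p(1) a by (simp add: Cons_in_idx)
      ultimately show "z \<in> lin_idx (a # P) ` idx (a # P)" by (rule image_eqI)
    qed
  qed
qed

lemma unfold_mat_entry:
  assumes "p \<in> idx P" "q \<in> idx Q"
  shows "unfold_mat P Q M $$ (lin_idx P p, lin_idx Q q) = M p q"
proof -
  have "inj_on (lin_idx P) (idx P)" "inj_on (lin_idx Q) (idx Q)"
    using bij_betw_lin_idx bij_betw_imp_inj_on by blast+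
  moreover have "lin_idx P p < prod_list P" "lin_idx Q q < prod_list Q"
    using bij_betw_apply[OF bij_betw_lin_idx assms(1)] bij_betw_apply[OF bij_betw_lin_idx assms(2)]
    by simp_all
  ultimately show ?thesis using assms by (simp add: unfold_mat_def)
qed

end

theory Submission
  imports Defs
begin

text \<open>
  Started at zero, the system reaches in T steps exactly the linear combinations of the columns of
  \<open>A\<^sup>p * B\<close> with \<open>p < T\<close>.  For a fixed column b of B, the vectors \<open>b, A * b, A\<^sup>2 * b, \<dots>\<close> live in a space of
  dimension \<open>n = J\<^sub>1 \<cdots> J\<^sub>N\<close>, so some \<open>A\<^sup>m * b\<close> with \<open>m \<le> n\<close> is a combination of the earlier ones, and
  then so are all later vectors; hence reaching a state at all means reaching it with the blocks
  \<open>p < n\<close>, which are the blocks of the reachability tensor.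
\<close>

section \<open>Linear recurrences in a finite-dimensional space\<close>

text \<open>A homogeneous system of \<open>card I\<close> equations in \<open>card I + 1\<close>
  unknowns has a nonzero solution. The vectors form an indexed family rather than a set, so
  repetitions among the \<open>w p\<close> count as dependencies.\<close>

lemma exists_dependency:
  fixes w :: "nat \<Rightarrow> 'i \<Rightarrow> real"
  assumes "finite I"
  shows "\<exists>c. (\<exists>p\<le>card I. c p \<noteq> 0) \<and> (\<forall>j\<in>I. (\<Sum>p\<le>card I. c p * w p j) = 0)"
proof -
  let ?n = "card I"
  obtain f where f: "bij_betw f {0..<?n} I"
    using ex_bij_betw_nat_finite[OF assms] by blast
  define M where "M = mat (Suc ?n) (Suc ?n) (\<lambda>(r, p). if r < ?n then w p (f r) else 0)"
  have M: "M \<in> carrier_mat (Suc ?n) (Suc ?n)" by (simp add: M_def)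
  \<comment> \<open>M is made square by a zero last row, so it is singular.\<close>
  have "det M = (\<Sum>p<Suc ?n. M $$ (?n, p) * cofactor M ?n p)"
    by (rule laplace_expansion_row[OF M]) simp
  also have "\<dots> = 0" by (rule sum.neutral) (simp add: M_def)
  finally obtain v where v: "v \<in> carrier_vec (Suc ?n)" "v \<noteq> 0\<^sub>v (Suc ?n)" "M *\<^sub>v v = 0\<^sub>v (Suc ?n)"
    using det_0_iff_vec_prod_zero[OF M] by blast
  have "(\<Sum>p\<le>?n. v $ p * w p j) = 0" if j: "j \<in> I" for j
  proof -
    obtain r where r: "r < ?n" "f r = j" using f j by (force simp: bij_betw_def)
    have "0 = (M *\<^sub>v v) $ r" using v(3) r by simp
    also have "\<dots> = (\<Sum>p<Suc ?n. M $$ (r, p) * v $ p)"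
      using M v(1) r by (simp add: scalar_prod_def lessThan_atLeast0)
    also have "\<dots> = (\<Sum>p<Suc ?n. v $ p * w p j)"
      using r by (intro sum.cong) (auto simp: M_def)
    finally show ?thesis by (simp add: lessThan_Suc_atMost)
  qed
  moreover have "\<exists>p\<le>?n. v $ p \<noteq> 0"
  proof (rule ccontr)
    assume "\<not> ?thesis"
    then have "v = 0\<^sub>v (Suc ?n)" using v(1) by (intro eq_vecI) auto
    with v(2) show False by simp
  qed
  ultimately show ?thesis by (intro exI[of _ "\<lambda>p. v $ p"] conjI) auto
qed

text \<open>Equality is required only on \<open>I\<close>, because tensor entries outside the index
  set carry no meaning. For \<open>m = 0\<close> the predicate says that \<open>x\<close> vanishes
  on \<open>I\<close>.\<close>

definition in_span_first :: "(nat \<Rightarrow> 'i \<Rightarrow> real) \<Rightarrow> 'i set \<Rightarrow> nat \<Rightarrow> ('i \<Rightarrow> real) \<Rightarrow> bool" where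
  "in_span_first w I m x \<longleftrightarrow> (\<exists>c. \<forall>j\<in>I. x j = (\<Sum>q<m. c q * w q j))"

lemma in_span_first_member:
  assumes "q < m"
  shows "in_span_first w I m (w q)"
proof -
  have "w q j = (\<Sum>r<m. (if r = q then 1 else 0) * w r j)" for j
  proof -
    have "w q j = (\<Sum>r<m. if r = q then w r j else 0)" using assms by simp
    also have "\<dots> = (\<Sum>r<m. (if r = q then 1 else 0) * w r j)" by (rule sum.cong) simp_all
    finally show ?thesis .
  qed
  then show ?thesis unfolding in_span_first_def by (intro exI[of _ "\<lambda>r. if r = q then 1 else 0"] ballI)
qed

lemma in_span_first_sum:
  assumes "\<And>q. q \<in> Q \<Longrightarrow> in_span_first w I m (x q)"
    and "\<And>j. j \<in> I \<Longrightarrow> y j = (\<Sum>q\<in>Q. c q * x q j)"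
  shows "in_span_first w I m y"
proof -
  obtain d where d: "\<And>q j. q \<in> Q \<Longrightarrow> j \<in> I \<Longrightarrow> x q j = (\<Sum>r<m. d q r * w r j)"
    using assms(1) unfolding in_span_first_def by metis
  have "y j = (\<Sum>r<m. (\<Sum>q\<in>Q. c q * d q r) * w r j)" if "j \<in> I" for j
  proof -
    have "y j = (\<Sum>q\<in>Q. \<Sum>r<m. c q * d q r * w r j)"
      using that by (simp add: assms(2) d sum_distrib_left mult.assoc)
    also have "\<dots> = (\<Sum>r<m. \<Sum>q\<in>Q. c q * d q r * w r j)" by (rule sum.swap)
    finally show ?thesis by (simp add: sum_distrib_right)
  qed
  then show ?thesis
    unfolding in_span_first_def by (intro exI[of _ "\<lambda>r. \<Sum>q\<in>Q. c q * d q r"] ballI)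
qed

text \<open>In a nontrivial dependency among \<open>w 0, ..., w (card I)\<close>, the equation can
  be solved for the vector with the largest index whose coefficient is nonzero.\<close>

lemma exists_in_span_of_predecessors:
  assumes "finite I"
  shows "\<exists>m\<le>card I. in_span_first w I m (w m)"
proof -
  obtain c where c: "\<exists>p\<le>card I. c p \<noteq> 0" and dep: "\<And>j. j \<in> I \<Longrightarrow> (\<Sum>p\<le>card I. c p * w p j) = 0"
    using exists_dependency[OF assms, of w] by blast
  define m where "m = Max {p. p \<le> card I \<and> c p \<noteq> 0}"
  have "m \<in> {p. p \<le> card I \<and> c p \<noteq> 0}"
    unfolding m_def using c by (intro Max_in) auto
  then have m: "m \<le> card I" "c m \<noteq> 0" by auto
  have above: "c p = 0" if "p \<le> card I" "m < p" for p
  proof (rule ccontr)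
    assume "c p \<noteq> 0"
    then have "p \<le> m" unfolding m_def using that by (intro Max_ge) auto
    with that show False by simp
  qed
  have "w m j = (\<Sum>q<m. (- c q / c m) * w q j)" if j: "j \<in> I" for j
  proof -
    have "0 = (\<Sum>p\<le>m. c p * w p j)"
      unfolding dep[OF j, symmetric] using m above by (intro sum.mono_neutral_right) auto
    then have "c m * w m j = - (\<Sum>q<m. c q * w q j)"
      by (simp add: lessThan_Suc_atMost[symmetric])
    then have "w m j = - (\<Sum>q<m. c q * w q j) / c m" using m(2) by (simp add: field_simps)
    then show ?thesis by (simp add: sum_divide_distrib sum_negf)
  qed
  then have "in_span_first w I m (w m)"
    unfolding in_span_first_def by (intro exI[of _ "\<lambda>q. - c q / c m"] ballI)
  with m(1) show ?thesis by blast
qed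

text \<open>Once \<open>w m\<close> depends on its predecessors, their span is invariant under
  \<open>a\<close>, so the whole orbit stays inside it. This gives the needed consequence of
  Cayley-Hamilton without a characteristic polynomial.\<close>

lemma recurrence_in_span_first:
  fixes a :: "'i \<Rightarrow> 'i \<Rightarrow> real"
  assumes "finite I"
    and step: "\<And>p j. j \<in> I \<Longrightarrow> w (Suc p) j = (\<Sum>i\<in>I. a j i * w p i)"
  shows "in_span_first w I (card I) (w t)"
proof -
  obtain m where m: "m \<le> card I" "in_span_first w I m (w m)"
    using exists_in_span_of_predecessors[OF assms(1)] by blast
  \<comment> \<open>Invariance on the generators: the shift of a generator is again a generator,
    except that the last one goes to \<open>w m\<close>, which is in the span by the choice of
    \<open>m\<close>.\<close>
  have succ: "in_span_first w I m (w (Suc q))" if "q < m" for q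
    using that m(2) by (cases "Suc q = m") (auto intro: in_span_first_member)
  have "in_span_first w I m (w t)"
  proof (induction t)
    case 0
    \<comment> \<open>For \<open>m = 0\<close> there are no generators, and the choice of
      \<open>m\<close> itself places \<open>w 0\<close> in the span.\<close>
    show ?case using m(2) by (cases "m = 0") (auto intro: in_span_first_member)
  next
    case (Suc t)
    then obtain c where c: "\<And>j. j \<in> I \<Longrightarrow> w t j = (\<Sum>q<m. c q * w q j)"
      unfolding in_span_first_def by blast
    have "w (Suc t) j = (\<Sum>q<m. c q * w (Suc q) j)" if "j \<in> I" for j
    proof -
      have "w (Suc t) j = (\<Sum>i\<in>I. \<Sum>q<m. c q * (a j i * w q i))"
        using that by (simp add: step c sum_distrib_left mult.left_commute)
      also have "\<dots> = (\<Sum>q<m. \<Sum>i\<in>I. c q * (a j i * w q i))" by (rule sum.swap)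
      finally show ?thesis using that by (simp add: step sum_distrib_left)
    qed
    moreover have "in_span_first w I m (w (Suc q))" if "q \<in> {..<m}" for q
      using that succ by simp
    ultimately show ?case by (rule in_span_first_sum[rotated])
  qed
  then obtain c where "\<And>j. j \<in> I \<Longrightarrow> w t j = (\<Sum>q<m. c q * w q j)"
    unfolding in_span_first_def by blast
  moreover have "in_span_first w I (card I) (w q)" if "q \<in> {..<m}" for q
    using that m(1) by (intro in_span_first_member) simp
  ultimately show ?thesis by (rule in_span_first_sum[rotated])
qed

section \<open>Trajectories\<close>

lemma finite_idx [simp]: "finite (idx P)"
  using bij_betw_finite[OF bij_betw_lin_idx] by blast

lemma card_idx: "card (idx P) = prod_list P"
  using bij_betw_same_card[OF bij_betw_lin_idx, of P] by simp

section \<open>Blocks of the reachability tensor and the response to inputs\<close>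

definition krylov :: "nat list \<Rightarrow> paired_tensor \<Rightarrow> paired_tensor \<Rightarrow> nat \<Rightarrow> paired_tensor" where
  "krylov J A B p = einstein J (einstein_pow J A p) B"

lemma krylov_0:
  assumes "j \<in> idx J"
  shows "krylov J A B 0 j k = B j k"
proof -
  have "krylov J A B 0 j k = (\<Sum>i\<in>idx J. if j = i then B i k else 0)"
    unfolding krylov_def einstein_def einstein_pow.simps id_tensor_def by (rule sum.cong) simp_all
  then show ?thesis using assms by simp
qed

text \<open>An instance of associativity of the Einstein product. For fixed \<open>k\<close> it is
  the linear recurrence to which the dimension argument applies.\<close>

lemma krylov_Suc: "krylov J A B (Suc p) j k = (\<Sum>i\<in>idx J. A j i * krylov J A B p i k)"
proof -
  have "krylov J A B (Suc p) j k
      = (\<Sum>l\<in>idx J. \<Sum>i\<in>idx J. A j i * (einstein_pow J A p i l * B l k))"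
    by (simp add: krylov_def einstein_def sum_distrib_right mult.assoc)
  also have "\<dots> = (\<Sum>i\<in>idx J. \<Sum>l\<in>idx J. A j i * (einstein_pow J A p i l * B l k))"
    by (rule sum.swap)
  finally show ?thesis by (simp add: krylov_def einstein_def sum_distrib_left)
qed

text \<open>The zero-state response after \<open>T\<close> steps. Inputs are indexed by delay and
  not by time: \<open>D p\<close> acts \<open>p + 1\<close> steps before the end, so
  \<open>A\<close> is applied to its effect \<open>p\<close> times.\<close>

definition forced ::
    "nat list \<Rightarrow> nat list \<Rightarrow> paired_tensor \<Rightarrow> paired_tensor \<Rightarrow> nat \<Rightarrow> (nat \<Rightarrow> tensor) \<Rightarrow> tensor" where
  "forced J K A B T D = (\<lambda>j. \<Sum>p<T. \<Sum>k\<in>idx K. D p k * krylov J A B p j k)"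

lemma forced_cong:
  assumes "\<And>p. p < T \<Longrightarrow> D p = D' p"
  shows "forced J K A B T D = forced J K A B T D'"
  using assms by (simp add: forced_def)

text \<open>The most recent input \<open>D 0\<close> enters through \<open>B\<close> alone; the
  contributions of all earlier inputs pass through \<open>A\<close> once more.\<close>

lemma forced_Suc:
  assumes "j \<in> idx J"
  shows "forced J K A B (Suc T) D j
    = einstein_vec J A (forced J K A B T (\<lambda>p. D (Suc p))) j + einstein_vec K B (D 0) j"
proof -
  have "(\<Sum>p<T. \<Sum>k\<in>idx K. D (Suc p) k * krylov J A B (Suc p) j k)
      = (\<Sum>p<T. \<Sum>k\<in>idx K. \<Sum>i\<in>idx J. A j i * (D (Suc p) k * krylov J A B p i k))"
    by (simp add: krylov_Suc sum_distrib_left mult.left_commute)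
  also have "\<dots> = (\<Sum>p<T. \<Sum>i\<in>idx J. \<Sum>k\<in>idx K. A j i * (D (Suc p) k * krylov J A B p i k))"
    by (intro sum.cong refl sum.swap)
  also have "\<dots> = (\<Sum>i\<in>idx J. \<Sum>p<T. \<Sum>k\<in>idx K. A j i * (D (Suc p) k * krylov J A B p i k))"
    by (rule sum.swap)
  also have "\<dots> = einstein_vec J A (forced J K A B T (\<lambda>p. D (Suc p))) j"
    by (simp add: einstein_vec_def forced_def sum_distrib_left)
  finally have tail: "(\<Sum>p<T. \<Sum>k\<in>idx K. D (Suc p) k * krylov J A B (Suc p) j k)
      = einstein_vec J A (forced J K A B T (\<lambda>p. D (Suc p))) j" .
  have head: "(\<Sum>k\<in>idx K. D 0 k * krylov J A B 0 j k) = einstein_vec K B (D 0) j"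
    by (simp add: einstein_vec_def krylov_0[OF assms] mult.commute)
  show ?thesis
    unfolding forced_def[of J K A B "Suc T"] sum.lessThan_Suc_shift head tail by (rule add.commute)
qed

lemma einstein_vec_cong:
  assumes "\<And>i. i \<in> idx J \<Longrightarrow> X i = Y i"
  shows "einstein_vec J A X = einstein_vec J A Y"
  using assms by (simp add: einstein_vec_def)

lemma einstein_vec_add:
  "einstein_vec J A (\<lambda>i. X i + Y i) j = einstein_vec J A X j + einstein_vec J A Y j"
  by (simp add: einstein_vec_def distrib_left sum.distrib)

text \<open>Discrete variation of constants: the state is the free evolution of \<open>X0\<close>
  plus the forced response. The argument \<open>s - Suc p\<close> turns the delay \<open>p\<close>
  into the time of the input.\<close>

lemma trajectory_eq:
  assumes init: "\<And>j. j \<in> idx J \<Longrightarrow> Y 0 j = X0 j"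
    and step: "\<And>s j. s < T \<Longrightarrow> j \<in> idx J \<Longrightarrow>
      Y (Suc s) j = einstein_vec J A (Y s) j + einstein_vec K B (U s) j"
    and "s \<le> T" "j \<in> idx J"
  shows "Y s j = (einstein_vec J A ^^ s) X0 j + forced J K A B s (\<lambda>p. U (s - Suc p)) j"
  using \<open>s \<le> T\<close> \<open>j \<in> idx J\<close>
proof (induction s arbitrary: j)
  case 0
  then show ?case by (simp add: init forced_def)
next
  case (Suc s)
  \<comment> \<open>The induction hypothesis describes \<open>Y s\<close> only on
    \<open>idx J\<close>, which is all that the Einstein product reads.\<close>
  have "einstein_vec J A (Y s) = einstein_vec J A (\<lambda>i. (einstein_vec J A ^^ s) X0 i
      + forced J K A B s (\<lambda>p. U (s - Suc p)) i)"
    using Suc by (intro einstein_vec_cong) auto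
  then show ?case using Suc.prems by (simp add: step einstein_vec_add forced_Suc)
qed

section \<open>Reachability as surjectivity of the forced response\<close>

definition forced_onto :: "nat list \<Rightarrow> nat list \<Rightarrow> paired_tensor \<Rightarrow> paired_tensor \<Rightarrow> nat \<Rightarrow> bool" where
  "forced_onto J K A B T \<longleftrightarrow> (\<forall>X. \<exists>D. \<forall>j\<in>idx J. X j = forced J K A B T D j)"

text \<open>Every column of every block is a combination of the same column in the first
  \<open>prod_list J\<close> blocks. Substituting these combinations and collecting coefficients
  rewrites any response of length \<open>T\<close>, whether \<open>T\<close> is below or above
  \<open>prod_list J\<close>.\<close>

lemma forced_onto_prod_list:
  assumes "forced_onto J K A B T"
  shows "forced_onto J K A B (prod_list J)"
  unfolding forced_onto_def
proof
  fix X :: tensor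
  obtain D where D: "\<And>j. j \<in> idx J \<Longrightarrow> X j = forced J K A B T D j"
    using assms unfolding forced_onto_def by blast
  have "in_span_first (\<lambda>p j. krylov J A B p j k) (idx J) (prod_list J) (\<lambda>j. krylov J A B p j k)" for p k
    unfolding card_idx[symmetric]
    by (rule recurrence_in_span_first[where a = A]) (simp_all add: krylov_Suc)
  then obtain c where c: "\<And>p k j. j \<in> idx J \<Longrightarrow>
      krylov J A B p j k = (\<Sum>q<prod_list J. c p k q * krylov J A B q j k)"
    unfolding in_span_first_def by metis
  have "X j = forced J K A B (prod_list J) (\<lambda>q k. \<Sum>p<T. D p k * c p k q) j" if j: "j \<in> idx J" for j
  proof -
    have "X j = (\<Sum>p<T. \<Sum>k\<in>idx K. D p k * (\<Sum>q<prod_list J. c p k q * krylov J A B q j k))"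
      by (simp only: D[OF j] forced_def c[OF j, symmetric])
    also have "\<dots> = (\<Sum>p<T. \<Sum>k\<in>idx K. \<Sum>q<prod_list J. D p k * c p k q * krylov J A B q j k)"
      by (simp add: sum_distrib_left mult.assoc)
    also have "\<dots> = (\<Sum>p<T. \<Sum>q<prod_list J. \<Sum>k\<in>idx K. D p k * c p k q * krylov J A B q j k)"
      by (intro sum.cong refl sum.swap)
    also have "\<dots> = (\<Sum>q<prod_list J. \<Sum>p<T. \<Sum>k\<in>idx K. D p k * c p k q * krylov J A B q j k)"
      by (rule sum.swap)
    also have "\<dots> = (\<Sum>q<prod_list J. \<Sum>k\<in>idx K. \<Sum>p<T. D p k * c p k q * krylov J A B q j k)"
      by (intro sum.cong refl sum.swap)
    finally show ?thesis by (simp add: forced_def sum_distrib_right)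
  qed
  then show "\<exists>D. \<forall>j\<in>idx J. X j = forced J K A B (prod_list J) D j" by (intro exI ballI)
qed

text \<open>Steering from the zero state leaves no free evolution, so the target is a pure forced
  response.\<close>

lemma reachable_on_imp_forced_onto:
  assumes "reachable_on J K A B t0 t1" "t0 < t1"
  shows "forced_onto J K A B (nat (t1 - t0))"
  unfolding forced_onto_def
proof
  fix X1 :: tensor
  let ?T = "nat (t1 - t0)"
  obtain U X where UX: "\<forall>j\<in>idx J. X t0 j = 0"
    "\<forall>t. t0 \<le> t \<and> t \<le> t1 - 1 \<longrightarrow>
      (\<forall>j\<in>idx J. X (t + 1) j = einstein_vec J A (X t) j + einstein_vec K B (U t) j)"
    "\<forall>j\<in>idx J. X t1 j = X1 j"
    using spec[OF spec[OF assms(1)[unfolded reachable_on_def], of "\<lambda>_. 0"], of X1]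
    by (elim exE conjE) (rule that)
  have free: "(einstein_vec J A ^^ s) (\<lambda>_. 0) = (\<lambda>_. 0)" for s
    by (induction s) (simp_all add: einstein_vec_def)
  have "X1 j = forced J K A B ?T (\<lambda>p. U (t0 + int (?T - Suc p))) j" if j: "j \<in> idx J" for j
  proof -
    have "X (t0 + int ?T) j = (einstein_vec J A ^^ ?T) (\<lambda>_. 0) j
        + forced J K A B ?T (\<lambda>p. U (t0 + int (?T - Suc p))) j"
    \<comment> \<open>Time is shifted by \<open>t0\<close>, which turns the integer interval into
      natural numbers starting at 0.\<close>
    proof (rule trajectory_eq[where Y = "\<lambda>s. X (t0 + int s)" and U = "\<lambda>s. U (t0 + int s)"])
      show "X (t0 + int (Suc s)) i
          = einstein_vec J A (X (t0 + int s)) i + einstein_vec K B (U (t0 + int s)) i"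
        if "s < ?T" "i \<in> idx J" for s i
        using UX(2)[rule_format, of "t0 + int s" i] that by (simp add: ac_simps)
    qed (use UX(1) j in simp_all)
    then show ?thesis using assms(2) by (simp add: free UX(3) j)
  qed
  then show "\<exists>D. \<forall>j\<in>idx J. X1 j = forced J K A B ?T D j" by (intro exI ballI)
qed

text \<open>The inputs have to produce only the difference between the target and the free evolution
  of the initial state.\<close>

lemma forced_onto_imp_reachable_on:
  assumes "forced_onto J K A B T"
  shows "reachable_on J K A B 0 (int T)"
  unfolding reachable_on_def
proof (intro allI)
  fix X0 X1 :: tensor
  obtain D where D: "\<And>j. j \<in> idx J \<Longrightarrow>
      X1 j - (einstein_vec J A ^^ T) X0 j = forced J K A B T D j"
    using spec[OF assms[unfolded forced_onto_def], of "\<lambda>j. X1 j - (einstein_vec J A ^^ T) X0 j"] by blast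
  \<comment> \<open>Delays are converted back to times: for \<open>p < T\<close>,
    \<open>U (T - Suc p)\<close> is \<open>D p\<close>.\<close>
  define U where "U s = D (T - Suc s)" for s
  define Y where "Y = rec_nat X0 (\<lambda>s Z j. einstein_vec J A Z j + einstein_vec K B (U s) j)"
  have Y: "Y 0 = X0" "Y (Suc s) = (\<lambda>j. einstein_vec J A (Y s) j + einstein_vec K B (U s) j)" for s
    by (simp_all add: Y_def)
  have "Y T j = X1 j" if j: "j \<in> idx J" for j
  proof -
    have "Y T j = (einstein_vec J A ^^ T) X0 j + forced J K A B T (\<lambda>p. U (T - Suc p)) j"
      by (rule trajectory_eq[where T = T]) (simp_all add: Y j)
    also have "forced J K A B T (\<lambda>p. U (T - Suc p)) = forced J K A B T D"
      by (rule forced_cong) (simp add: U_def Suc_diff_Suc)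
    finally show ?thesis using D[OF j] by simp
  qed
  then show "\<exists>U X. (\<forall>j\<in>idx J. X 0 j = X0 j) \<and>
      (\<forall>t. 0 \<le> t \<and> t \<le> int T - 1 \<longrightarrow>
        (\<forall>j\<in>idx J. X (t + 1) j = einstein_vec J A (X t) j + einstein_vec K B (U t) j)) \<and>
      (\<forall>j\<in>idx J. X (int T) j = X1 j)"
    by (intro exI[of _ "\<lambda>t. U (nat t)"] exI[of _ "\<lambda>t. Y (nat t)"]) (simp add: Y nat_add_distrib)
qed

lemma reachable_iff_forced_onto:
  assumes "prod_list J > 0"
  shows "reachable J K A B \<longleftrightarrow> forced_onto J K A B (prod_list J)"
proof
  assume "reachable J K A B"
  then show "forced_onto J K A B (prod_list J)"
    unfolding reachable_def using reachable_on_imp_forced_onto forced_onto_prod_list by blast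
next
  assume "forced_onto J K A B (prod_list J)"
  then show "reachable J K A B"
    \<comment> \<open>Positivity of \<open>prod_list J\<close> makes the horizon from 0 to
      \<open>prod_list J\<close> a proper interval.\<close>
    unfolding reachable_def using assms
    by (intro exI[of _ 0] exI[of _ "int (prod_list J)"] conjI forced_onto_imp_reachable_on) simp_all
qed

section \<open>Columns and rank of the reachability tensor\<close>

text \<open>Division with remainder in each mode: the quotients are the block coordinates, the
  remainders the indices inside the block, and the witness recombines them.\<close>

lemma bij_betw_block_coordinates:
  assumes "length J = length K"
  shows "bij_betw (\<lambda>q. (map2 (div) q K, map2 (mod) q K)) (idx (map2 (*) J K)) (idx J \<times> idx K)"
proof (rule bij_betw_byWitness[where f' = "\<lambda>(p, k). map2 (+) (map2 (*) p K) k"])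
  show "\<forall>q\<in>idx (map2 (*) J K). (case (map2 (div) q K, map2 (mod) q K) of
      (p, k) \<Rightarrow> map2 (+) (map2 (*) p K) k) = q"
    using assms by (auto simp: idx_def div_mult_mod_eq intro!: nth_equalityI)
  show "\<forall>x\<in>idx J \<times> idx K. (case (case x of (p, k) \<Rightarrow> map2 (+) (map2 (*) p K) k) of
      q \<Rightarrow> (map2 (div) q K, map2 (mod) q K)) = x"
    using assms by (auto simp: idx_def intro!: nth_equalityI)
  show "(\<lambda>q. (map2 (div) q K, map2 (mod) q K)) ` idx (map2 (*) J K) \<subseteq> idx J \<times> idx K"
  proof (rule image_subsetI)
    fix q assume "q \<in> idx (map2 (*) J K)"
    then have l: "length q = length K" and q: "\<And>n. n < length K \<Longrightarrow> q ! n < J ! n * K ! n"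
      using assms by (auto simp: idx_def)
    \<comment> \<open>The bound \<open>q ! n < J ! n * K ! n\<close> forces \<open>K ! n\<close> to
      be positive, as the remainder estimate requires.\<close>
    have "q ! n div K ! n < J ! n" "q ! n mod K ! n < K ! n" if "n < length K" for n
      using q[OF that] by (auto simp: less_mult_imp_div_less intro!: mod_less_divisor gr0I)
    then show "(map2 (div) q K, map2 (mod) q K) \<in> idx J \<times> idx K"
      using l assms by (simp add: idx_def)
  qed
  show "(\<lambda>(p, k). map2 (+) (map2 (*) p K) k) ` (idx J \<times> idx K) \<subseteq> idx (map2 (*) J K)"
  proof (rule image_subsetI, clarify)
    fix p k assume p: "p \<in> idx J" and k: "k \<in> idx K"
    have "p ! n * K ! n + k ! n < J ! n * K ! n" if "n < length K" for n
    proof -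
      have "Suc (p ! n) \<le> J ! n" "k ! n < K ! n" using p k assms that by (auto simp: idx_def)
      then have "Suc (p ! n) * K ! n \<le> J ! n * K ! n" by (intro mult_le_mono1)
      with \<open>k ! n < K ! n\<close> show ?thesis by simp
    qed
    then show "map2 (+) (map2 (*) p K) k \<in> idx (map2 (*) J K)"
      using p k assms by (simp add: idx_def)
  qed
qed

lemma bij_betw_column_index:
  assumes "length J = length K"
  shows "bij_betw (\<lambda>q. (lin_idx J (map2 (div) q K), map2 (mod) q K))
    (idx (map2 (*) J K)) ({..<prod_list J} \<times> idx K)"
proof -
  have "bij_betw (map_prod (lin_idx J) id) (idx J \<times> idx K) ({..<prod_list J} \<times> idx K)"
    by (intro bij_betw_map_prod bij_betw_lin_idx bij_betw_id)
  from bij_betw_trans[OF bij_betw_block_coordinates[OF assms] this]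
  show ?thesis by (simp add: o_def)
qed

text \<open>A column of the reachability tensor is a pair of a block number \<open>p\<close> and a
  column \<open>k\<close> of that block. Under this reindexing, coefficients of columns are the same
  data as delayed inputs \<open>D p k\<close>.\<close>

lemma spans_iff_forced_onto:
  assumes "length J = length K"
  shows "spans J (map2 (*) J K) (reach_tensor J K A B) \<longleftrightarrow> forced_onto J K A B (prod_list J)"
proof -
  let ?Q = "idx (map2 (*) J K)"
  let ?g = "\<lambda>q. (lin_idx J (map2 (div) q K), map2 (mod) q K)"
  have entry: "reach_tensor J K A B j q = (case ?g q of (p, k) \<Rightarrow> krylov J A B p j k)" for j q
    by (simp add: reach_tensor_def row_block_def krylov_def)
  have sum: "(\<Sum>q\<in>?Q. (case ?g q of (p, k) \<Rightarrow> D p k) * reach_tensor J K A B j q)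
      = forced J K A B (prod_list J) D j" for D j
    using sum.reindex_bij_betw[OF bij_betw_column_index[OF assms],
        of "\<lambda>(p, k). D p k * krylov J A B p j k"]
    by (simp add: entry forced_def sum.cartesian_product)
  show ?thesis
  proof
    assume L: "spans J (map2 (*) J K) (reach_tensor J K A B)"
    show "forced_onto J K A B (prod_list J)"
      unfolding forced_onto_def
    proof
      fix X :: tensor
      obtain C where C: "\<forall>j\<in>idx J. X j = (\<Sum>q\<in>?Q. C q * reach_tensor J K A B j q)"
        using L unfolding spans_def by blast
      \<comment> \<open>The coefficients are transported along the inverse of the column
        bijection.\<close>
      define D where "D p k = C (inv_into ?Q ?g (p, k))" for p k
      have "(case ?g q of (p, k) \<Rightarrow> D p k) = C q" if "q \<in> ?Q" for q
        using bij_betw_inv_into_left[OF bij_betw_column_index[OF assms] that] by (simp add: D_def)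
      then have "\<forall>j\<in>idx J. X j = forced J K A B (prod_list J) D j"
        unfolding sum[symmetric] using C by simp
      then show "\<exists>D. \<forall>j\<in>idx J. X j = forced J K A B (prod_list J) D j" by (rule exI[of _ D])
    qed
  next
    assume R: "forced_onto J K A B (prod_list J)"
    show "spans J (map2 (*) J K) (reach_tensor J K A B)"
      unfolding spans_def
    proof
      fix X :: tensor
      obtain D where "\<forall>j\<in>idx J. X j = forced J K A B (prod_list J) D j"
        using R unfolding forced_onto_def by blast
      then show "\<exists>C. \<forall>j\<in>idx J. X j = (\<Sum>q\<in>?Q. C q * reach_tensor J K A B j q)"
        unfolding sum[symmetric] by (rule exI[of _ "\<lambda>q. case ?g q of (p, k) \<Rightarrow> D p k"])
    qed
  qed
qed

text \<open>The rank is the size of a maximal independent set of columns. If that size is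
  \<open>n\<close>, the set is a basis of the whole space; conversely, the rank is the dimension of
  the column space.\<close>

lemma (in vec_space) rank_eq_dim_iff_col_space:
  assumes M: "M \<in> carrier_mat n nc"
  shows "rank M = n \<longleftrightarrow> col_space M = carrier_vec n"
proof
  have cols: "set (cols M) \<subseteq> carrier_vec n" using M cols_dim by blast
  assume r: "rank M = n"
  obtain S where S: "maximal S (\<lambda>T. T \<subseteq> set (cols M) \<and> lin_indpt T)"
    using maximal_exists_superset[of "set (cols M)" "\<lambda>T. T \<subseteq> set (cols M) \<and> lin_indpt T" "{}"]
    by (auto simp: lin_dep_def)
  then have sub: "S \<subseteq> set (cols M)" and li: "lin_indpt S" by (auto simp: maximal_def)
  have "card S = n" using rank_card_indpt[OF M S] r by simp
  then have "basis S"
    using sub li cols by (intro dim_li_is_basis) (auto simp: dim_is_n intro: finite_subset)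
  then have "span S = carrier_vec n" by (simp add: basis_def)
  moreover have "span S \<subseteq> span (set (cols M))" using sub by (rule span_is_monotone)
  moreover have "span (set (cols M)) \<subseteq> carrier_vec n" using span_closed cols by auto
  ultimately show "col_space M = carrier_vec n" by (auto simp: col_space_def)
next
  assume "col_space M = carrier_vec n"
  \<comment> \<open>The subspace whose dimension defines the rank is now the ambient space
    itself.\<close>
  then have "span_vs (set (cols M)) = V" by (simp add: col_space_def)
  then show "rank M = n" unfolding rank_def by (simp add: dim_is_n)
qed

text \<open>Unfolding only relabels rows and columns along \<open>lin_idx\<close>, so combinations
  of subtensors become matrix-vector products. Spanning then means that the matrix is surjective,
  which is full row rank.\<close>

lemma spans_iff_rank_U: "spans P Q M \<longleftrightarrow> rank_U P Q M = prod_list P"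
proof -
  let ?M = "unfold_mat P Q M" and ?m = "prod_list P" and ?n = "prod_list Q"
  have M: "?M \<in> carrier_mat ?m ?n" by (simp add: unfold_mat_def)
  have bP: "bij_betw (lin_idx P) (idx P) {..<?m}" and bQ: "bij_betw (lin_idx Q) (idx Q) {..<?n}"
    by (rule bij_betw_lin_idx)+
  have mult: "(?M *\<^sub>v vec ?n c) $ lin_idx P p = (\<Sum>q\<in>idx Q. c (lin_idx Q q) * M p q)"
    if p: "p \<in> idx P" for c p
  proof -
    have "lin_idx P p < ?m" using bij_betw_apply[OF bP p] by simp
    then have "(?M *\<^sub>v vec ?n c) $ lin_idx P p = (\<Sum>i<?n. c i * ?M $$ (lin_idx P p, i))"
      using M by (simp add: scalar_prod_def lessThan_atLeast0 mult.commute)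
    also have "\<dots> = (\<Sum>q\<in>idx Q. c (lin_idx Q q) * ?M $$ (lin_idx P p, lin_idx Q q))"
      by (rule sum.reindex_bij_betw[OF bQ, symmetric])
    finally show ?thesis using p by (simp add: unfold_mat_entry)
  qed
  have "rank_U P Q M = ?m \<longleftrightarrow> vec_space.col_space ?m ?M = carrier_vec ?m"
    unfolding rank_U_def by (rule vec_space.rank_eq_dim_iff_col_space[OF M])
  also have "\<dots> \<longleftrightarrow> (\<forall>x\<in>carrier_vec ?m. \<exists>c\<in>carrier_vec ?n. ?M *\<^sub>v c = x)"
    using M by (auto simp: vec_space.col_space_eq[OF M])
  also have "\<dots> \<longleftrightarrow> spans P Q M"
  proof
    assume L: "\<forall>x\<in>carrier_vec ?m. \<exists>c\<in>carrier_vec ?n. ?M *\<^sub>v c = x"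
    show "spans P Q M"
      unfolding spans_def
    proof
      fix X :: tensor
      \<comment> \<open>The vectorization of \<open>X\<close> in the same row order as the
        unfolding.\<close>
      let ?x = "vec ?m (\<lambda>i. X (inv_into (idx P) (lin_idx P) i))"
      obtain c where c: "c \<in> carrier_vec ?n" "?M *\<^sub>v c = ?x" using L by force
      have "X p = (\<Sum>q\<in>idx Q. c $ lin_idx Q q * M p q)" if p: "p \<in> idx P" for p
      proof -
        have "vec ?n (\<lambda>i. c $ i) = c" using c(1) by auto
        moreover have "?x $ lin_idx P p = X p"
          using bij_betw_apply[OF bP p] bij_betw_inv_into_left[OF bP p] by simp
        ultimately show ?thesis using mult[OF p, of "\<lambda>i. c $ i"] c(2) by simp
      qed
      then show "\<exists>C. \<forall>p\<in>idx P. X p = (\<Sum>q\<in>idx Q. C q * M p q)"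
        by (intro exI[of _ "\<lambda>q. c $ lin_idx Q q"] ballI)
    qed
  next
    assume R: "spans P Q M"
    show "\<forall>x\<in>carrier_vec ?m. \<exists>c\<in>carrier_vec ?n. ?M *\<^sub>v c = x"
    proof
      fix x :: "real vec" assume x: "x \<in> carrier_vec ?m"
      obtain C where C: "\<And>p. p \<in> idx P \<Longrightarrow> x $ lin_idx P p = (\<Sum>q\<in>idx Q. C q * M p q)"
        using spec[OF R[unfolded spans_def], of "\<lambda>p. x $ lin_idx P p"] by blast
      let ?c = "vec ?n (\<lambda>i. C (inv_into (idx Q) (lin_idx Q) i))"
      have "?M *\<^sub>v ?c = x"
      proof (rule eq_vecI)
        fix i assume "i < dim_vec x"
        then have "i \<in> lin_idx P ` idx P"
          using x by (simp add: bij_betw_imp_surj_on[OF bP])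
        then obtain p where p: "p \<in> idx P" "lin_idx P p = i" by blast
        show "(?M *\<^sub>v ?c) $ i = x $ i"
          using mult[OF p(1)] C[OF p(1)] p(2) by (simp add: bij_betw_inv_into_left[OF bQ])
      qed (use M x in simp)
      then show "\<exists>c\<in>carrier_vec ?n. ?M *\<^sub>v c = x" by (intro bexI[of _ ?c]) simp_all
    qed
  qed
  finally show ?thesis by simp
qed

theorem proposition5p8:
  fixes N :: nat and J K :: "nat list" and A B :: paired_tensor
  assumes "N \<ge> 1" "length J = N" "length K = N"
    and "\<forall>n<N. J ! n \<ge> 1" "\<forall>n<N. K ! n \<ge> 1"
  shows "(reachable J K A B \<longleftrightarrow> spans J (map2 (*) J K) (reach_tensor J K A B)) \<and>
         (reachable J K A B \<longleftrightarrow> rank_U J (map2 (*) J K) (reach_tensor J K A B) = prod_list J)"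
proof -
  \<comment> \<open>Positive mode sizes have a positive product, which serves as the length of the
    steering horizon.\<close>
  have "0 \<notin> set J" using assms(2,4) by (force simp: in_set_conv_nth)
  then have "prod_list J > 0" by (metis gr0I prod_list_zero_iff)
  then have "reachable J K A B \<longleftrightarrow> spans J (map2 (*) J K) (reach_tensor J K A B)"
    using assms(2,3) by (simp add: reachable_iff_forced_onto spans_iff_forced_onto)
  then show ?thesis by (simp add: spans_iff_rank_U)
qed

end
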